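(* Let $\mathbf{A}_\phi$ be a graph shift operator associated with the adjacency matrix $\mathbf{A}\in\mathbb{R}^{N\times N}$ of a graph, and let $L_{\mathbf{A}_\phi}$ be the degree of the minimal polynomial of $\mathbf{A}_\phi$. Let $\mathbf{H}=\sum_{k=0}^{L-1}h_k\mathbf{A}_\phi^k$ be a linear shift invariant (LSI) filter with taps $h_0,\dots,h_{L-1}$. When $L_{\mathbf{A}_\phi}\le L$, there exists an equivalent form of this LSI filter, $$\mathbf{H}=\breve{h}(\mathbf{A}_\phi)=\sum_{k=0}^{L_{\mathbf{A}_\phi}-1}\breve{h}_k\mathbf{A}_\phi^k .$$ Moreover, there exists a closed-form expression for the filter taps $\breve{h}_k$ as a function of the taps $h_k$.
   Context: A graph on $N$ nodes is given by a real weighted adjacency matrix $\mathbf{A}\in\mathbb{R}^{N\times N}$ (directed or undirected), assumed diagonalizable with eigenspaces of dimension one: $\mathbf{A}=\mathbf{V}\boldsymbol{\Lambda}\mathbf{V}^{-1}$ with $\mathbf{V}\in\mathbb{C}^{N\times N}$ invertible and $\boldsymbol{\Lambda}$ diagonal. Graph shift operator: $\mathbf{A}_\phi=\mathbf{V}\boldsymbol{\Lambda}_\phi\mathbf{V}^{-1}$ with $\boldsymbol{\Lambda}_\phi=\mathrm{diag}(e^{j\phi_1},\dots,e^{j\phi_N})$, where $j=\sqrt{-1}$ and $\phi_1,\dots,\phi_N\in[0,2\pi]$ are arbitrary phases with $\phi_k\ne\phi_l$ for $k\neq l$. A linear graph filter is a matrix $\mathbf{H}\in\mathbb{C}^{N\times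 N}$ acting on graph signals $\mathbf{x}\in\mathbb{C}^N$ by $\mathbf{x}\mapsto\mathbf{H}\mathbf{x}$; it is linear shift invariant (LSI) if $\mathbf{H}\mathbf{A}_\phi\mathbf{x}=\mathbf{A}_\phi\mathbf{H}\mathbf{x}$ for graph signals $\mathbf{x}$. LSI filters are written as polynomials $\mathbf{H}=h(\mathbf{A}_\phi)=\sum_{k=0}^{L-1}h_k\mathbf{A}_\phi^k$ in the shift operator, where $h_k$ is called the $k$-th tap and $L-1$ is the order of the polynomial representation. *)

theory Defs
  imports
    Complex_Main
    "Jordan_Normal_Form.Char_Poly"
    "Jordan_Normal_Form.Matrix_Kernel"
begin

abbreviation complex_mat :: "real mat \<Rightarrow> complex mat" where
  "complex_mat A \<equiv> map_mat complex_of_real A"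

text \<open>
  \<open>A = V * \<Lambda> * W\<close> over the complex numbers with \<open>W\<close> the inverse of \<open>V\<close> and \<open>\<Lambda>\<close> diagonal.
  The kernel of \<^term>\<open>char_matrix B e\<close>, that is of \<open>B - e I\<close>, is the eigenspace of \<open>B\<close> at \<open>e\<close>.
\<close>
definition simple_diagonalization ::
    "real mat \<Rightarrow> complex mat \<Rightarrow> complex mat \<Rightarrow> complex mat \<Rightarrow> bool" where
  "simple_diagonalization A V \<Lambda> W \<longleftrightarrow>
     similar_mat_wit (complex_mat A) \<Lambda> V W \<and> diagonal_mat \<Lambda> \<and>
     (\<forall>e. eigenvalue (complex_mat A) e \<longrightarrow> kernel_dim (char_matrix (complex_mat A) e) = 1)"

text \<open>
  Phases are indexed from 0. The interval is closed, so the phases 0 and \<open>2 * pi\<close> may both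
  occur; in that case two diagonal entries of the shift coincide.
\<close>
definition graph_shift_operator ::
    "nat \<Rightarrow> real mat \<Rightarrow> (nat \<Rightarrow> real) \<Rightarrow> complex mat \<Rightarrow> bool" where
  "graph_shift_operator N A \<phi> S \<longleftrightarrow>
     A \<in> carrier_mat N N \<and>
     (\<forall>k<N. \<phi> k \<in> {0..2 * pi}) \<and> inj_on \<phi> {..<N} \<and>
     (\<exists>V \<Lambda> W. simple_diagonalization A V \<Lambda> W \<and> S = V * mat_diag N (\<lambda>k. cis (\<phi> k)) * W)"

text \<open>
  The matrix \<open>\<Sum>k<L. h k \<cdot> S\<^sup>k\<close>, written entrywise because square matrices of a given size do not
  form a type with a zero element.
\<close>
definition polynomial_filter ::
    "complex mat \<Rightarrow> nat \<Rightarrow> (nat \<Rightarrow> complex) \<Rightarrow> complex mat" where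
  "polynomial_filter S L h =
     mat (dim_row S) (dim_row S) (\<lambda>(i, j). \<Sum>k<L. h k * (S ^\<^sub>m k) $$ (i, j))"

definition linear_shift_invariant :: "nat \<Rightarrow> complex mat \<Rightarrow> complex mat \<Rightarrow> bool" where
  "linear_shift_invariant N S H \<longleftrightarrow>
     H \<in> carrier_mat N N \<and> (\<forall>x \<in> carrier_vec N. (H * S) *\<^sub>v x = (S * H) *\<^sub>v x)"

definition annihilates :: "complex poly \<Rightarrow> complex mat \<Rightarrow> bool" where
  "annihilates p S \<longleftrightarrow>
     polynomial_filter S (Suc (degree p)) (coeff p) = 0\<^sub>m (dim_row S) (dim_row S)"

definition minimal_polynomial :: "complex mat \<Rightarrow> complex poly" where
  "minimal_polynomial S = (THE p. monic p \<and> annihilates p S \<and>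
     (\<forall>q. q \<noteq> 0 \<and> annihilates q S \<longrightarrow> degree p \<le> degree q))"

definition elem_sym :: "nat \<Rightarrow> complex set \<Rightarrow> complex" where
  "elem_sym r E = (\<Sum>T | T \<subseteq> E \<and> card T = r. \<Prod>T)"

text \<open>
  The \<open>k\<close>-th coefficient of the polynomial of degree less than \<^term>\<open>card E\<close> that agrees with
  \<open>\<Sum>n<L. h n * x ^ n\<close> at every point of the finite set \<open>E\<close>. Its Lagrange form is the sum over
  \<open>z \<in> E\<close> of \<open>(\<Sum>n<L. h n * z ^ n) * (\<Prod>w\<in>E - {z}. (x - w) / (z - w))\<close>, and by Vieta the
  coefficient of \<open>x ^ k\<close> in \<open>\<Prod>w\<in>E - {z}. (x - w)\<close> is the signed elementary symmetric function
  of degree \<open>card E - 1 - k\<close>.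
\<close>
definition reduced_tap ::
    "complex set \<Rightarrow> nat \<Rightarrow> (nat \<Rightarrow> complex) \<Rightarrow> nat \<Rightarrow> complex" where
  "reduced_tap E L h k =
     (\<Sum>n<L. h n * (\<Sum>z\<in>E. z ^ n *
        ((-1) ^ (card E - 1 - k) * elem_sym (card E - 1 - k) (E - {z})
           / (\<Prod>w\<in>E - {z}. z - w))))"

end

(* Conjugating by the eigenvector matrix turns a polynomial filter into the diagonal matrix of the
   values of its polynomial at the eigenvalues of the shift. So two filters agree iff their
   polynomials agree on the set E of eigenvalues, the minimal polynomial is the product of x - z
   over E, and the reduced taps are the coefficients of the Lagrange interpolant on E. *)
theory Submission
  imports Defs
begin

text \<open>Vieta: expanding the product picks \<open>- w\<close> from the factors with
  \<open>w\<close> in a subset \<open>X\<close> and \<open>x\<close> from all others. Grouping the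
  subsets by cardinality \<open>r\<close> collects \<open>elem_sym r F\<close>.\<close>

lemma prod_diff_elem_sym:
  assumes "finite F"
  shows "(\<Prod>w\<in>F. x - w) = (\<Sum>r\<le>card F. (-1) ^ r * elem_sym r F * x ^ (card F - r))"
proof -
  have fin: "finite T" if "T \<subseteq> F" for T
    using that assms finite_subset by blast
  have "(\<Prod>w\<in>F. x - w) = (\<Sum>X\<in>Pow F. (-1) ^ card X * \<Prod>X * x ^ (card F - card X))"
    by (subst prod_diff_conv_sum[OF assms]) (auto intro!: sum.cong simp: card_Diff_subset fin)
  also have "\<dots> = (\<Sum>r\<le>card F. \<Sum>X | X \<in> Pow F \<and> card X = r.
      (-1) ^ card X * \<Prod>X * x ^ (card F - card X))"
    by (rule sum.group[symmetric]) (use assms in \<open>auto intro: card_mono\<close>)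
  also have "\<dots> = (\<Sum>r\<le>card F. (-1) ^ r * elem_sym r F * x ^ (card F - r))"
    by (rule sum.cong) (auto simp: elem_sym_def sum_distrib_left sum_distrib_right intro!: sum.cong)
  finally show ?thesis .
qed

text \<open>Vieta for the numerator of a Lagrange basis polynomial, sorted by powers of
  \<open>x\<close> so that the coefficients have the shape used in
  \<open>reduced_tap\<close>.\<close>

lemma prod_diff_elem_sym_ascending:
  assumes "finite E" "z \<in> E"
  shows "(\<Sum>k<card E. (-1) ^ (card E - 1 - k) * elem_sym (card E - 1 - k) (E - {z}) * x ^ k)
    = (\<Prod>w\<in>E - {z}. x - w)"
proof -
  define n where "n = card E"
  have n: "card (E - {z}) = n - 1" "n > 0"
    using assms by (auto simp: n_def card_gt_0_iff)
  \<comment> \<open>This needs \<open>n > 0\<close>, which holds because \<open>z\<close> lies in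
    \<open>E\<close>.\<close>
  have "{..<n} = {..n - 1}"
    using n by auto
  then have "(\<Prod>w\<in>E - {z}. x - w)
      = (\<Sum>r<n. (-1) ^ r * elem_sym r (E - {z}) * x ^ (n - 1 - r))"
    using prod_diff_elem_sym[of "E - {z}" x] assms n by simp
  also have "\<dots> = (\<Sum>k<n. (-1) ^ (n - Suc k) * elem_sym (n - Suc k) (E - {z})
      * x ^ (n - 1 - (n - Suc k)))"
    by (rule sum.nat_diff_reindex[symmetric])
  also have "\<dots> = (\<Sum>k<n. (-1) ^ (n - 1 - k) * elem_sym (n - 1 - k) (E - {z}) * x ^ k)"
    by (rule sum.cong) auto
  finally show ?thesis
    by (simp add: n_def)
qed

lemma reduced_tap_interpolates:
  assumes E: "finite E" "x \<in> E"
  shows "(\<Sum>k<card E. reduced_tap E L h k * x ^ k) = (\<Sum>n<L. h n * x ^ n)"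
proof -
  define c where "c z k = (-1) ^ (card E - 1 - k) * elem_sym (card E - 1 - k) (E - {z})" for z k
  define d where "d z = (\<Prod>w\<in>E - {z}. z - w)" for z
  \<comment> \<open>This quotient is the Lagrange basis polynomial of \<open>z\<close> evaluated at
    \<open>x\<close>. For \<open>z \<noteq> x\<close> the product has the factor
    \<open>x - x\<close>; for \<open>z = x\<close> the numerator is \<open>d z\<close>, a product of
    nonzero differences.\<close>
  have c: "(\<Sum>k<card E. c z k * x ^ k) / d z = (if z = x then 1 else 0)" if "z \<in> E" for z
  proof -
    have "(\<Sum>k<card E. c z k * x ^ k) = (\<Prod>w\<in>E - {z}. x - w)"
      unfolding c_def by (rule prod_diff_elem_sym_ascending[OF E(1) that])
    then show ?thesis
      using E by (auto simp: d_def)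
  qed
  have "(\<Sum>k<card E. reduced_tap E L h k * x ^ k)
      = (\<Sum>k<card E. \<Sum>n<L. \<Sum>z\<in>E. h n * z ^ n * (c z k * x ^ k / d z))"
    unfolding reduced_tap_def c_def d_def
    by (simp add: sum_distrib_left sum_distrib_right mult_ac)
  \<comment> \<open>Moving the sum over \<open>k\<close> innermost exposes the basis polynomial for
    each fixed \<open>n\<close> and \<open>z\<close>.\<close>
  also have "\<dots> = (\<Sum>n<L. \<Sum>z\<in>E. \<Sum>k<card E. h n * z ^ n * (c z k * x ^ k / d z))"
    by (subst sum.swap, intro sum.cong refl, subst sum.swap) simp
  also have "\<dots> = (\<Sum>n<L. \<Sum>z\<in>E. h n * z ^ n * ((\<Sum>k<card E. c z k * x ^ k) / d z))"
    by (simp only: sum_distrib_left sum_divide_distrib)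
  also have "\<dots> = (\<Sum>n<L. \<Sum>z\<in>E. if z = x then h n * z ^ n else 0)"
    by (intro sum.cong refl) (simp add: c)
  also have "\<dots> = (\<Sum>n<L. h n * x ^ n)"
    using E by simp
  finally show ?thesis .
qed

lemma pow_mat_diag:
  fixes d :: "nat \<Rightarrow> 'a :: comm_semiring_1"
  shows "mat_diag N d ^\<^sub>m k = mat_diag N (\<lambda>i. d i ^ k)"
proof (induction k)
  case 0
  then show ?case
    by (simp add: carrier_matD(1)[OF mat_diag_dim])
next
  case (Suc k)
  then show ?case
    by (simp add: mult.commute)
qed

text \<open>Shows entrywise that the conjugate is linear in \<open>d\<close>, so that linear
  combinations of conjugates can be formed on the diagonal.\<close>

lemma conjugated_mat_diag_index:
  assumes "V \<in> carrier_mat N N" "W \<in> carrier_mat N N" "i < N" "j < N"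
  shows "(V * mat_diag N d * W) $$ (i, j) = (\<Sum>l<N. V $$ (i, l) * d l * W $$ (l, j))"
  using assms by (auto simp: mat_diag_mult_right[of _ N N] scalar_prod_def atLeast0LessThan)

text \<open>Powers of \<open>S\<close> are conjugates of powers of the diagonal matrix by the same
  \<open>V\<close> and \<open>W\<close>, and conjugation is linear.\<close>

lemma polynomial_filter_similar_mat_diag:
  fixes V W :: "complex mat"
  assumes wit: "similar_mat_wit S (mat_diag N d) V W" and S: "S \<in> carrier_mat N N"
  shows "polynomial_filter S L h = V * mat_diag N (\<lambda>i. \<Sum>k<L. h k * d i ^ k) * W"
proof (rule eq_matI)
  note sim = similar_mat_witD2[OF S wit]
  show "dim_row (polynomial_filter S L h) = dim_row (V * mat_diag N (\<lambda>i. \<Sum>k<L. h k * d i ^ k) * W)"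
    "dim_col (polynomial_filter S L h) = dim_col (V * mat_diag N (\<lambda>i. \<Sum>k<L. h k * d i ^ k) * W)"
    using sim by (auto simp: polynomial_filter_def)
  fix i j
  assume "i < dim_row (V * mat_diag N (\<lambda>i. \<Sum>k<L. h k * d i ^ k) * W)"
    "j < dim_col (V * mat_diag N (\<lambda>i. \<Sum>k<L. h k * d i ^ k) * W)"
  then have ij: "i < N" "j < N"
    using sim by auto
  have "polynomial_filter S L h $$ (i, j)
      = (\<Sum>k<L. h k * (V * mat_diag N (\<lambda>i. d i ^ k) * W) $$ (i, j))"
    using ij S by (simp add: polynomial_filter_def similar_mat_wit_pow_id[OF wit] pow_mat_diag)
  also have "\<dots> = (\<Sum>k<L. \<Sum>l<N. V $$ (i, l) * (h k * d l ^ k) * W $$ (l, j))"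
    using ij sim(6,7)
    by (simp add: conjugated_mat_diag_index[of V N W] sum_distrib_left mult_ac del: index_mult_mat)
  \<comment> \<open>Swapping the sums gathers the value of the filter polynomial at each eigenvalue
    \<open>d l\<close>.\<close>
  also have "\<dots> = (\<Sum>l<N. V $$ (i, l) * (\<Sum>k<L. h k * d l ^ k) * W $$ (l, j))"
    by (subst sum.swap) (simp add: sum_distrib_left sum_distrib_right)
  also have "\<dots> = (V * mat_diag N (\<lambda>i. \<Sum>k<L. h k * d i ^ k) * W) $$ (i, j)"
    using ij sim(6,7) by (simp add: conjugated_mat_diag_index del: index_mult_mat)
  finally show "polynomial_filter S L h $$ (i, j)
      = (V * mat_diag N (\<lambda>i. \<Sum>k<L. h k * d i ^ k) * W) $$ (i, j)" .
qed

text \<open>Conjugation by an invertible matrix is injective, so the filter vanishes exactly when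
  its diagonal of polynomial values does.\<close>

lemma annihilates_iff_roots:
  fixes V W :: "complex mat"
  assumes wit: "similar_mat_wit S (mat_diag N d) V W" and S: "S \<in> carrier_mat N N"
  shows "annihilates p S \<longleftrightarrow> (\<forall>i<N. poly p (d i) = 0)"
proof -
  note sim = similar_mat_witD2[OF S wit]
  let ?D = "mat_diag N (\<lambda>i. poly p (d i))"
  have filter: "polynomial_filter S (Suc (degree p)) (coeff p) = V * ?D * W"
    using polynomial_filter_similar_mat_diag[OF wit S, of "Suc (degree p)" "coeff p"]
    by (simp add: poly_altdef lessThan_Suc_atMost)
  \<comment> \<open>Read backwards, the similarity recovers \<open>?D\<close> as
    \<open>W * (V * ?D * W) * V\<close>, so a zero filter forces \<open>?D\<close> to be
    zero.\<close>
  have sim_filter: "similar_mat_wit ?D (V * ?D * W) W V"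
    by (rule similar_mat_wit_sym, rule similar_mat_witI[OF sim(1,2) refl])
      (use sim in \<open>auto intro!: mult_carrier_mat[of _ N N]\<close>)
  have "annihilates p S \<longleftrightarrow> V * ?D * W = 0\<^sub>m N N"
    using S by (auto simp: annihilates_def filter)
  also have "\<dots> \<longleftrightarrow> ?D = 0\<^sub>m N N"
  proof
    assume "V * ?D * W = 0\<^sub>m N N"
    then show "?D = 0\<^sub>m N N"
      using similar_mat_witD2(3)[OF mat_diag_dim sim_filter] sim by simp
  next
    assume "?D = 0\<^sub>m N N"
    then show "V * ?D * W = 0\<^sub>m N N"
      using sim by simp
  qed
  also have "\<dots> \<longleftrightarrow> (\<forall>i<N. poly p (d i) = 0)"
    by (auto simp: mat_eq_iff mat_diag_def)
  finally show ?thesis .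
qed

lemma monic_root_product:
  fixes E :: "'a :: idom set"
  assumes "finite E"
  shows "monic (\<Prod>z\<in>E. [:-z, 1:])" "degree (\<Prod>z\<in>E. [:-z, 1:]) = card E"
proof -
  show "monic (\<Prod>z\<in>E. [:-z, 1:])"
    by (rule monic_prod) simp
  show "degree (\<Prod>z\<in>E. [:-z, 1:]) = card E"
    using assms by (simp add: degree_prod_eq_sum_degree)
qed

lemma card_roots_le_degree:
  fixes p :: "'a :: idom poly"
  assumes "p \<noteq> 0" "\<forall>z\<in>E. poly p z = 0"
  shows "card E \<le> degree p"
proof -
  have "card E \<le> card {z. poly p z = 0}"
    using assms by (intro card_mono poly_roots_finite) auto
  also have "\<dots> \<le> degree p"
    using poly_roots_degree[OF assms(1)] .
  finally show ?thesis .
qed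

text \<open>Annihilating \<open>S\<close> means vanishing on the set of diagonal values. The product
  runs over this set, so a repeated eigenvalue contributes a single factor.\<close>

lemma minimal_polynomial_similar_mat_diag:
  fixes V W :: "complex mat"
  assumes wit: "similar_mat_wit S (mat_diag N d) V W" and S: "S \<in> carrier_mat N N"
  shows "minimal_polynomial S = (\<Prod>z\<in>d ` {..<N}. [:-z, 1:])"
proof -
  define E where "E = d ` {..<N}"
  define P where "P = (\<Prod>z\<in>E. [:-z, 1:])"
  have E: "finite E"
    by (simp add: E_def)
  have ann: "annihilates p S \<longleftrightarrow> (\<forall>z\<in>E. poly p z = 0)" for p
    by (auto simp: annihilates_iff_roots[OF wit S] E_def)
  have P: "monic P" "degree P = card E" "\<forall>z\<in>E. poly P z = 0"
    using E monic_root_product[OF E] by (auto simp: P_def poly_prod)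
  show ?thesis
    unfolding minimal_polynomial_def ann E_def[symmetric] P_def[symmetric]
  proof (rule the_equality)
    show "monic P \<and> (\<forall>z\<in>E. poly P z = 0) \<and>
        (\<forall>q. q \<noteq> 0 \<and> (\<forall>z\<in>E. poly q z = 0) \<longrightarrow> degree P \<le> degree q)"
      using P card_roots_le_degree by metis
  next
    fix p
    assume p: "monic p \<and> (\<forall>z\<in>E. poly p z = 0) \<and>
        (\<forall>q. q \<noteq> 0 \<and> (\<forall>z\<in>E. poly q z = 0) \<longrightarrow> degree p \<le> degree q)"
    have "P \<noteq> 0" "p \<noteq> 0"
      using P p by auto
    \<comment> \<open>The upper bound is the minimality of \<open>p\<close> tested against
      \<open>P\<close>; the lower bound counts roots.\<close>
    then have deg: "degree p = card E"
      using P p card_roots_le_degree[of p E] by (metis antisym)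
    show "p = P"
    proof (rule ccontr)
      assume "p \<noteq> P"
      \<comment> \<open>The difference vanishes on all of \<open>E\<close>, yet the leading terms of
        the two monic polynomials cancel at degree \<open>card E\<close>.\<close>
      then have "card E \<le> degree (p - P)"
        using p P by (intro card_roots_le_degree) auto
      moreover have "degree (p - P) \<le> card E"
        using deg P by (intro degree_diff_le) auto
      ultimately have "coeff (p - P) (card E) \<noteq> 0"
        using \<open>p \<noteq> P\<close> by (metis antisym leading_coeff_0_iff right_minus_eq)
      then show False
        using p P deg by auto
    qed
  qed
qed

theorem theorem4:
  fixes A :: "real mat" and S H :: "complex mat" and \<phi> :: "nat \<Rightarrow> real"
    and h :: "nat \<Rightarrow> complex" and N L :: nat
  assumes "graph_shift_operator N A \<phi> S"
    and "H = polynomial_filter S L h"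
    and "linear_shift_invariant N S H"
    and "degree (minimal_polynomial S) \<le> L"
  shows "\<exists>b :: nat \<Rightarrow> complex.
    H = polynomial_filter S (degree (minimal_polynomial S)) b \<and>
    (\<forall>k < degree (minimal_polynomial S).
       b k = reduced_tap ((\<lambda>i. cis (\<phi> i)) ` {..<N}) L h k)"
proof -
  let ?d = "\<lambda>i. cis (\<phi> i)"
  let ?E = "?d ` {..<N}"
  obtain V \<Lambda> W where A: "A \<in> carrier_mat N N"
    and simA: "similar_mat_wit (complex_mat A) \<Lambda> V W"
    and S_eq: "S = V * mat_diag N ?d * W"
    using assms(1) unfolding graph_shift_operator_def simple_diagonalization_def by blast
  have "complex_mat A \<in> carrier_mat N N"
    using A by simp
  note VW = similar_mat_witD2[OF this simA]
  have S: "S \<in> carrier_mat N N"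
    unfolding S_eq using VW by (intro mult_carrier_mat[of _ N N] mat_diag_dim)
  \<comment> \<open>The shift inherits the eigenvector matrix of \<open>A\<close>: the same mutually
    inverse \<open>V\<close> and \<open>W\<close> diagonalize it.\<close>
  have wit: "similar_mat_wit S (mat_diag N ?d) V W"
    using VW S S_eq by (intro similar_mat_witI) auto
  \<comment> \<open>The degree counts distinct eigenvalues, which are fewer than \<open>N\<close>
    when the phases 0 and \<open>2 * pi\<close> both occur.\<close>
  have deg: "degree (minimal_polynomial S) = card ?E"
    unfolding minimal_polynomial_similar_mat_diag[OF wit S] by (simp add: monic_root_product)
  \<comment> \<open>The interpolant agrees with the given polynomial at every eigenvalue, so both
    have the same diagonal matrix of values.\<close>
  have "mat_diag N (\<lambda>i. \<Sum>k<card ?E. reduced_tap ?E L h k * ?d i ^ k)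
      = mat_diag N (\<lambda>i. \<Sum>k<L. h k * ?d i ^ k)"
    by (rule eq_matI) (auto simp: mat_diag_def reduced_tap_interpolates)
  then have "H = polynomial_filter S (degree (minimal_polynomial S)) (reduced_tap ?E L h)"
    by (simp only: assms(2) deg polynomial_filter_similar_mat_diag[OF wit S])
  \<comment> \<open>The witness is \<open>reduced_tap ?E L h\<close> itself, which makes the closed
    form hold by reflexivity.\<close>
  then show ?thesis
    by blast
qed

end
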